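(* Let $R$ be a finite noncommutative ring such that $|R|\neq 8$, and let $r\in K(R)$. Then $\Delta_R^r$ has an end vertex if and only if $r\neq 0$ and $R$ is isomorphic to $E(9)$ or $F(9)$.
   Context: Rings are associative and not assumed to have a unity. $[x,y]:=xy-yx$ and $K(R):=\{[x,y]:x,y\in R\}$. $Z(R)$ is the center of $R$. $\Delta_R^r$ is the simple undirected graph with vertex set $R\setminus Z(R)$ in which two distinct vertices $x,y$ are adjacent if and only if $[x,y]\neq r$ and $[x,y]\neq -r$. An end vertex is a vertex of degree $1$. For a prime $p$, $E(p^2)=\langle a,b: pa=pb=0,\ a^2=a,\ b^2=b,\ ab=a,\ ba=b\rangle$ and $F(p^2)=\langle x,y: px=py=0,\ x^2=x,\ y^2=y,\ xy=y,\ yx=x\rangle$; these are (non-unital) rings of order $p^2$ whose additive group is free over $\mathbb{Z}/p$ on the two generators, with multiplication determined bilinearly by the given relations. *)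

theory Defs
  imports Main "HOL-Library.Numeral_Type"
begin

text \<open>Type class \<open>ring\<close>: associative, no unit assumed. A finite ring is a type of sort
  \<open>{ring, finite}\<close>, so \<open>|R|\<close> is \<open>CARD('a)\<close>.\<close>

definition commutator :: "'a::ring \<Rightarrow> 'a \<Rightarrow> 'a"
  where "commutator x y = x * y - y * x"

definition commutator_set :: "'a::ring set"
  where "commutator_set = {commutator x y | x y. True}"

definition ring_center :: "'a::ring set"
  where "ring_center = {z. \<forall>x. z * x = x * z}"

definition ring_isomorphism :: "('a::ring \<Rightarrow> 'b::ring) \<Rightarrow> bool"
  where "ring_isomorphism f \<longleftrightarrow> bij f \<and>
    (\<forall>x y. f (x + y) = f x + f y) \<and> (\<forall>x y. f (x * y) = f x * f y)"


text \<open>The graph \<open>\<Delta>\<^sub>R\<^sup>r\<close>; undirected edges are two-element sets of vertices.\<close>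

definition Delta_verts :: "'a::ring set"
  where "Delta_verts = UNIV - ring_center"

definition Delta_edges :: "'a::ring \<Rightarrow> 'a set set"
  where "Delta_edges r = {{x, y} | x y. x \<in> Delta_verts \<and> y \<in> Delta_verts \<and> x \<noteq> y \<and>
    commutator x y \<noteq> r \<and> commutator x y \<noteq> - r}"

definition graph_degree :: "'v set set \<Rightarrow> 'v \<Rightarrow> nat"
  where "graph_degree E v = card {e \<in> E. v \<in> e}"

definition end_vertex :: "'v set \<Rightarrow> 'v set set \<Rightarrow> 'v \<Rightarrow> bool"
  where "end_vertex V E v \<longleftrightarrow> v \<in> V \<and> graph_degree E v = 1"


text \<open>\<open>E_elem s t\<close> is \<open>s a + t b\<close>, where \<open>a\<^sup>2 = a\<close>, \<open>b\<^sup>2 = b\<close>, \<open>a b = a\<close>, \<open>b a = b\<close>; the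
  product is the bilinear extension of these relations. With coefficients in the numeral
  type \<open>p\<close> (integers modulo \<open>p\<close>) this is \<open>E(p\<^sup>2)\<close>; in particular \<open>E(9)\<close> is \<open>3 E_ring\<close>.\<close>

datatype 'k E_ring = E_elem (E_a: 'k) (E_b: 'k)

instantiation E_ring :: (comm_ring_1) ring
begin

definition "0 = E_elem 0 0"
definition "x + y = E_elem (E_a x + E_a y) (E_b x + E_b y)"
definition "- x = E_elem (- E_a x) (- E_b x)"
definition "x - y = E_elem (E_a x - E_a y) (E_b x - E_b y)"
definition "x * y = E_elem (E_a x * E_a y + E_a x * E_b y) (E_b x * E_a y + E_b x * E_b y)"

instance
  by standard
    (simp_all add: zero_E_ring_def plus_E_ring_def uminus_E_ring_def minus_E_ring_def
      times_E_ring_def E_ring.expand algebra_simps)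

end

lemma E_ring_relations:
  fixes a b :: "'k::comm_ring_1 E_ring"
  defines "a \<equiv> E_elem 1 0" and "b \<equiv> E_elem 0 1"
  shows "a * a = a" "b * b = b" "a * b = a" "b * a = b"
  by (simp_all add: a_def b_def times_E_ring_def)

text \<open>\<open>F_elem s t\<close> is \<open>s x + t y\<close>, where \<open>x\<^sup>2 = x\<close>, \<open>y\<^sup>2 = y\<close>, \<open>x y = y\<close>, \<open>y x = x\<close>;
  analogously, \<open>F(9)\<close> is \<open>3 F_ring\<close>.\<close>

datatype 'k F_ring = F_elem (F_x: 'k) (F_y: 'k)

instantiation F_ring :: (comm_ring_1) ring
begin

definition "0 = F_elem 0 0"
definition "u + v = F_elem (F_x u + F_x v) (F_y u + F_y v)"
definition "- u = F_elem (- F_x u) (- F_y u)"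
definition "u - v = F_elem (F_x u - F_x v) (F_y u - F_y v)"
definition "u * v = F_elem (F_x u * F_x v + F_y u * F_x v) (F_x u * F_y v + F_y u * F_y v)"

instance
  by standard
    (simp_all add: zero_F_ring_def plus_F_ring_def uminus_F_ring_def minus_F_ring_def
      times_F_ring_def F_ring.expand algebra_simps)

end

lemma F_ring_relations:
  fixes x y :: "'k::comm_ring_1 F_ring"
  defines "x \<equiv> F_elem 1 0" and "y \<equiv> F_elem 0 1"
  shows "x * x = x" "y * y = y" "x * y = y" "y * x = x"
  by (simp_all add: x_def y_def times_F_ring_def)

end

theory Submission
  imports Defs
begin

text \<open>
  For a vertex \<open>v\<close> the solution sets of \<open>[v, x] = \<plusminus> r\<close> are empty or cosets of the centralizer
  \<open>C(v)\<close>. For \<open>r = 0\<close> the degree \<open>|R| - |C(v)|\<close> of \<open>v\<close> is at least \<open>|C(v)| \<ge> 2\<close>. If \<open>v\<close> is an end vertex and \<open>r \<noteq> 0\<close>, counting gives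
  \<open>|R| = |Z(R)| + 2 + c |C(v)|\<close> with \<open>c \<le> 2\<close>, and \<open>2 |Z(R)| \<le> |C(v)|\<close>, so that \<open>|C(v)|\<close> is \<open>3\<close> or \<open>4\<close>.
  As \<open>[v, x]\<close> is annihilated by both \<open>|C(v)|\<close> and its index, these are not coprime; this leaves
  \<open>|R| = 8\<close>, or \<open>|R| = 9\<close> with trivial centre. In the second case every \<open>C(x)\<close> with \<open>x \<noteq> 0\<close> is the
  line through \<open>x\<close>, which forces \<open>x\<^sup>2 \<in> {0, x, - x}\<close>. This yields an idempotent \<open>e\<close> and a
  square-zero \<open>n\<close> with \<open>e n + n e = n\<close>, and then \<open>e n \<in> {0, n}\<close> decides between \<open>E(9)\<close> and \<open>F(9)\<close>.
\<close>

section \<open>Neighbourhoods\<close>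

definition neighbours :: "'a::ring \<Rightarrow> 'a \<Rightarrow> 'a set"
  where "neighbours r v = {x. x \<notin> ring_center \<and> x \<noteq> v \<and> commutator v x \<noteq> r \<and> commutator v x \<noteq> - r}"

lemma commutator_swap: "commutator y x = - commutator x (y::'a::ring)"
  by (simp add: commutator_def)

text \<open>Edges at \<open>v\<close> correspond to their other endpoints. Adjacency may be tested
  with \<open>v\<close> on the left: swapping the arguments only changes the sign of the commutator,
  and both \<open>r\<close> and \<open>- r\<close> are excluded.\<close>

lemma graph_degree_Delta:
  fixes v :: "'a::ring"
  assumes "v \<notin> ring_center"
  shows "graph_degree (Delta_edges r) v = card (neighbours r v)"
proof -
  have "{e \<in> Delta_edges r. v \<in> e} = (\<lambda>x. {v, x}) ` neighbours r v"
  proof (intro equalityI subsetI)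
    fix e assume "e \<in> {e \<in> Delta_edges r. v \<in> e}"
    then obtain x y where e: "e = {x, y}" "x \<notin> ring_center" "y \<notin> ring_center" "x \<noteq> y"
      "commutator x y \<noteq> r" "commutator x y \<noteq> - r" "v = x \<or> v = y"
      by (auto simp: Delta_edges_def Delta_verts_def)
    from e(7) show "e \<in> (\<lambda>x. {v, x}) ` neighbours r v"
    proof
      assume "v = x" with e show ?thesis by (auto simp: neighbours_def)
    next
      assume "v = y"
      then have "x \<in> neighbours r v"
        using e commutator_swap[of y x] by (auto simp: neighbours_def)
      with e(1) \<open>v = y\<close> show ?thesis by (auto simp: insert_commute)
    qed
  next
    fix e assume "e \<in> (\<lambda>x. {v, x}) ` neighbours r v"
    then show "e \<in> {e \<in> Delta_edges r. v \<in> e}"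
      using assms by (auto simp: neighbours_def Delta_edges_def Delta_verts_def)
  qed
  moreover have "inj_on (\<lambda>x. {v, x}) (neighbours r v)"
    by (auto simp: inj_on_def doubleton_eq_iff)
  ultimately show ?thesis by (simp add: graph_degree_def card_image)
qed

lemma end_vertex_iff:
  "end_vertex Delta_verts (Delta_edges r) v \<longleftrightarrow> v \<notin> ring_center \<and> card (neighbours r v) = 1"
  by (auto simp: end_vertex_def Delta_verts_def graph_degree_Delta)

section \<open>Transport along a ring isomorphism\<close>

context
  fixes f :: "'a::ring \<Rightarrow> 'b::ring"
  assumes iso: "ring_isomorphism f"
begin

lemma iso_bij: "bij f" and iso_add: "f (x + y) = f x + f y" and iso_mult: "f (x * y) = f x * f y"
  using iso by (auto simp: ring_isomorphism_def)

lemma iso_diff: "f (x - y) = f x - f y"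
  using iso_add[of "x - y" y] by (simp add: algebra_simps)

lemma iso_zero: "f 0 = 0"
  using iso_diff[of 0 0] by simp

lemma iso_minus: "f (- x) = - f x"
  using iso_diff[of 0 x] by (simp add: iso_zero)

lemma iso_eq_iff: "f x = f y \<longleftrightarrow> x = y"
  using iso_bij by (simp add: bij_is_inj inj_eq)

lemma iso_commutator: "f (commutator x y) = commutator (f x) (f y)"
  by (simp add: commutator_def iso_diff iso_mult)

lemma iso_surj: "\<exists>x. y = f x"
  using iso_bij by (metis bij_pointE)

lemma iso_center: "f x \<in> ring_center \<longleftrightarrow> x \<in> ring_center"
  unfolding ring_center_def mem_Collect_eq by (metis iso_eq_iff iso_surj iso_mult)

lemma iso_neighbours: "neighbours (f r) (f v) = f ` neighbours r v"
proof (intro equalityI subsetI)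
  fix y assume "y \<in> neighbours (f r) (f v)"
  moreover obtain x where "y = f x" using iso_surj by blast
  ultimately show "y \<in> f ` neighbours r v"
    by (auto simp: neighbours_def iso_center iso_eq_iff simp flip: iso_commutator iso_minus)
next
  fix y assume "y \<in> f ` neighbours r v"
  then show "y \<in> neighbours (f r) (f v)"
    by (auto simp: neighbours_def iso_center iso_eq_iff simp flip: iso_commutator iso_minus)
qed

lemma iso_end_vertex:
  "end_vertex Delta_verts (Delta_edges (f r)) (f v) \<longleftrightarrow> end_vertex Delta_verts (Delta_edges r) v"
  using iso_bij by (simp add: end_vertex_iff iso_center iso_neighbours card_image bij_is_inj
    inj_on_subset[of f UNIV])

lemma iso_commutator_set: "f r \<in> commutator_set \<longleftrightarrow> r \<in> commutator_set"
  unfolding commutator_set_def mem_Collect_eq by (metis iso_eq_iff iso_surj iso_commutator)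

text \<open>Reduces the converse direction to computations in E(9) and F(9): \<open>f r\<close> is
  again a nonzero commutator, and its end vertex pulls back along \<open>f\<close>.\<close>

lemma iso_ex_end_vertex:
  fixes r :: 'a
  assumes "r \<in> commutator_set" "r \<noteq> 0"
    and "\<And>s. s \<in> commutator_set \<Longrightarrow> s \<noteq> 0 \<Longrightarrow> \<exists>v::'b. end_vertex Delta_verts (Delta_edges s) v"
  shows "\<exists>v. end_vertex Delta_verts (Delta_edges r) v"
  using assms(3)[of "f r"] assms(1,2) iso_surj iso_end_vertex
  by (metis iso_commutator_set iso_eq_iff iso_zero)

end

section \<open>End vertices of \<open>E(9)\<close> and \<open>F(9)\<close>\<close>

lemma three_cases: "(t::3) = 0 \<or> t = 1 \<or> t = - 1"
proof -
  have "card {0, 1, - 1 :: 3} = CARD(3)" by simp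
  then have "{0, 1, - 1 :: 3} = UNIV" by (intro card_subset_eq) auto
  then show ?thesis by blast
qed

text \<open>\<open>d\<close> is the determinant of the two coordinate vectors, so all commutators
  are multiples of a - b.\<close>

lemma commutator_E:
  "commutator u v = (let d = E_a u * E_b v - E_b u * E_a v in E_elem d (- d))"
  by (simp add: commutator_def times_E_ring_def minus_E_ring_def Let_def algebra_simps)

lemma commutator_F:
  "commutator u v = (let d = F_y u * F_x v - F_x u * F_y v in F_elem d (- d))"
  by (simp add: commutator_def times_F_ring_def minus_F_ring_def Let_def algebra_simps)

lemma ring_center_commutator: "z \<in> ring_center \<longleftrightarrow> (\<forall>x. commutator z x = 0)"
  by (simp add: ring_center_def commutator_def)

lemma commutator_center_right: "z \<in> ring_center \<Longrightarrow> commutator x z = 0"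
  by (simp add: ring_center_def commutator_def)

lemma E_end_vertex:
  assumes "r \<in> commutator_set" "r \<noteq> (0 :: 3 E_ring)"
  shows "\<exists>v. end_vertex Delta_verts (Delta_edges r) v"
proof -
  obtain d where r: "r = E_elem d (- d)"
    using assms(1) unfolding commutator_set_def commutator_E Let_def by blast
  then have d: "d = 1 \<or> d = - 1"
    using assms(2) three_cases[of d] by (auto simp: zero_E_ring_def)
  have center: "u \<in> ring_center \<longleftrightarrow> u = 0" for u :: "3 E_ring"
  proof
    assume "u \<in> ring_center"
    then have "commutator u (E_elem 0 1) = 0" "commutator u (E_elem 1 0) = 0"
      by (simp_all add: ring_center_commutator)
    then show "u = 0"
      by (simp add: commutator_E zero_E_ring_def Let_def E_ring.expand)
  qed (simp add: ring_center_def)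
  \<comment> \<open>The bracket of a with s a + t b is t (a - b). As \<open>d\<close> is 1 or -1,
    avoiding \<open>r\<close> and \<open>- r\<close> means t = 0; of the multiples 0, a, -a the
    first is central and the second is the vertex itself.\<close>
  have "neighbours r (E_elem 1 0) = {E_elem (- 1) 0}"
  proof (intro equalityI subsetI)
    fix x assume x: "x \<in> neighbours r (E_elem 1 0)"
    obtain s t where st: "x = E_elem s t" by (cases x)
    have "t = 0" and "s \<noteq> 0" "s \<noteq> 1"
      using x d three_cases[of t]
      by (auto simp: st neighbours_def r center commutator_E Let_def uminus_E_ring_def zero_E_ring_def)
    then show "x \<in> {E_elem (- 1) 0}" using st three_cases[of s] by auto
  next
    fix x :: "3 E_ring" assume "x \<in> {E_elem (- 1) 0}"
    then show "x \<in> neighbours r (E_elem 1 0)"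
      using d by (auto simp: neighbours_def r center commutator_E Let_def uminus_E_ring_def zero_E_ring_def)
  qed
  then have "end_vertex Delta_verts (Delta_edges r) (E_elem 1 0)"
    by (simp add: end_vertex_iff center zero_E_ring_def)
  then show ?thesis ..
qed

lemma F_end_vertex:
  assumes "r \<in> commutator_set" "r \<noteq> (0 :: 3 F_ring)"
  shows "\<exists>v. end_vertex Delta_verts (Delta_edges r) v"
proof -
  obtain d where r: "r = F_elem d (- d)"
    using assms(1) unfolding commutator_set_def commutator_F Let_def by blast
  then have d: "d = 1 \<or> d = - 1"
    using assms(2) three_cases[of d] by (auto simp: zero_F_ring_def)
  have center: "u \<in> ring_center \<longleftrightarrow> u = 0" for u :: "3 F_ring"
  proof
    assume "u \<in> ring_center"
    then have "commutator u (F_elem 0 1) = 0" "commutator u (F_elem 1 0) = 0"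
      by (simp_all add: ring_center_commutator)
    then show "u = 0"
      by (simp add: commutator_F zero_F_ring_def Let_def F_ring.expand)
  qed (simp add: ring_center_def)
  \<comment> \<open>As for E(9), except that the bracket of x with s x + t y is -t (x - y); the sign
    is harmless since \<open>r\<close> and \<open>- r\<close> are both avoided.\<close>
  have "neighbours r (F_elem 1 0) = {F_elem (- 1) 0}"
  proof (intro equalityI subsetI)
    fix x assume x: "x \<in> neighbours r (F_elem 1 0)"
    obtain s t where st: "x = F_elem s t" by (cases x)
    have "t = 0" and "s \<noteq> 0" "s \<noteq> 1"
      using x d three_cases[of t]
      by (auto simp: st neighbours_def r center commutator_F Let_def uminus_F_ring_def zero_F_ring_def)
    then show "x \<in> {F_elem (- 1) 0}" using st three_cases[of s] by auto
  next
    fix x :: "3 F_ring" assume "x \<in> {F_elem (- 1) 0}"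
    then show "x \<in> neighbours r (F_elem 1 0)"
      using d by (auto simp: neighbours_def r center commutator_F Let_def uminus_F_ring_def zero_F_ring_def)
  qed
  then have "end_vertex Delta_verts (Delta_edges r) (F_elem 1 0)"
    by (simp add: end_vertex_iff center zero_F_ring_def)
  then show ?thesis ..
qed

section \<open>Counting\<close>

definition centralizer :: "'a::ring \<Rightarrow> 'a set"
  where "centralizer v = {x. commutator v x = 0}"

lemma commutator_add_right: "commutator v (x + y) = commutator v x + commutator v (y::'a::ring)"
  by (simp add: commutator_def algebra_simps)

lemma commutator_diff_right: "commutator v (x - y) = commutator v x - commutator v (y::'a::ring)"
  by (simp add: commutator_def algebra_simps)

text \<open>\<open>commutator v\<close> is additive with kernel \<open>centralizer v\<close>, so a
  nonempty fibre is a translate of the kernel.\<close>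

lemma card_commutator_fibre:
  fixes v :: "'a::{ring,finite}"
  assumes "c \<in> range (commutator v)"
  shows "card {x. commutator v x = c} = card (centralizer v)"
proof -
  obtain w where w: "c = commutator v w" using assms by auto
  have "{x. commutator v x = c} = (+) w ` centralizer v"
  proof (intro equalityI subsetI)
    fix x assume "x \<in> {x. commutator v x = c}"
    then have "x - w \<in> centralizer v" by (simp add: centralizer_def commutator_diff_right w)
    then show "x \<in> (+) w ` centralizer v" by (intro image_eqI[of _ _ "x - w"]) auto
  qed (auto simp: centralizer_def commutator_add_right w)
  then show ?thesis by (simp add: card_image)
qed

lemma card_range_commutator:
  fixes v :: "'a::{ring,finite}"
  shows "CARD('a) = card (range (commutator v)) * card (centralizer v)"
proof -
  have "CARD('a) = (\<Sum>c\<in>range (commutator v). card {x \<in> UNIV. commutator v x = c})"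
    using sum.group[of UNIV "range (commutator v)" "commutator v" "\<lambda>_. 1::nat"] by simp
  also have "\<dots> = (\<Sum>c\<in>range (commutator v). card (centralizer v))"
    by (intro sum.cong) (simp_all add: card_commutator_fibre)
  finally show ?thesis by simp
qed

text \<open>Translation by \<open>x\<close> permutes the finite set \<open>H\<close>, so the sum
  over \<open>H\<close> is unchanged by adding \<open>x\<close> to each term. In the absence of a
  unity, the multiple of \<open>x\<close> is written as a constant sum.\<close>

lemma card_multiple_eq_0:
  fixes x :: "'a::{ab_group_add,finite}"
  assumes "\<And>y z. y \<in> H \<Longrightarrow> z \<in> H \<Longrightarrow> y + z \<in> H" "x \<in> H"
  shows "(\<Sum>i<card H. x) = 0"
proof -
  have "(+) x ` H = H"
    by (rule card_subset_eq) (use assms in \<open>auto simp: card_image\<close>)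
  then have "\<Sum>H = (\<Sum>h\<in>H. x + h)"
    using sum.reindex[of "(+) x" H "\<lambda>h. h"] by (simp add: o_def)
  also have "\<dots> = (\<Sum>h\<in>H. x) + \<Sum>H" by (simp add: sum.distrib)
  finally have "(\<Sum>h\<in>H. x) = 0" by simp
  moreover obtain g where "bij_betw g {..<card H} H"
    using ex_bij_betw_nat_finite[of H] by (auto simp: atLeast0LessThan)
  ultimately show ?thesis using sum.reindex_bij_betw[of g "{..<card H}" H "\<lambda>_. x"] by simp
qed

lemma centralizer_self: "v \<in> centralizer v"
  by (simp add: centralizer_def commutator_def)

lemma centralizer_multiple_eq_0:
  fixes v :: "'a::{ring,finite}"
  shows "(\<Sum>i<card (centralizer v). v) = 0"
  by (rule card_multiple_eq_0) (simp_all add: centralizer_self, simp add: centralizer_def commutator_add_right)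

lemma range_commutator_multiple_eq_0:
  fixes v :: "'a::{ring,finite}"
  shows "(\<Sum>i<card (range (commutator v)). commutator v x) = 0"
proof (rule card_multiple_eq_0)
  fix y z assume "y \<in> range (commutator v)" "z \<in> range (commutator v)"
  then show "y + z \<in> range (commutator v)" by (auto simp flip: commutator_add_right)
qed auto

lemma commutator_sum_left:
  "commutator (\<Sum>i\<in>A. f i) x = (\<Sum>i\<in>A. commutator (f i) (x::'a::ring))"
  by (simp add: commutator_def sum_distrib_left sum_distrib_right sum_subtractf)

text \<open>The order of the centralizer kills \<open>v\<close> and hence, by additivity in the left
  argument, each bracket with \<open>v\<close>.\<close>

lemma centralizer_multiple_commutator_eq_0:
  fixes v :: "'a::{ring,finite}"
  shows "(\<Sum>i<card (centralizer v). commutator v x) = 0"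
  using commutator_sum_left[of "\<lambda>_. v" "{..<card (centralizer v)}" x]
  unfolding centralizer_multiple_eq_0 by (simp add: commutator_def)

text \<open>The centralizer contains the centre and its translate by \<open>v\<close>, which are
  disjoint as \<open>v\<close> is not central.\<close>

lemma two_card_center_le:
  fixes v :: "'a::{ring,finite}"
  assumes "v \<notin> ring_center"
  shows "2 * card (ring_center :: 'a set) \<le> card (centralizer v)"
proof -
  let ?Z = "ring_center :: 'a set"
  have "?Z \<inter> (+) v ` ?Z = {}"
    using assms by (force simp: ring_center_def algebra_simps)
  then have "card (?Z \<union> (+) v ` ?Z) = 2 * card ?Z"
    by (simp add: card_Un_disjoint card_image)
  moreover have "?Z \<union> (+) v ` ?Z \<subseteq> centralizer v"
    by (auto simp: centralizer_def commutator_def ring_center_def algebra_simps)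
  ultimately show ?thesis by (metis card_mono finite)
qed

lemma card_center_pos: "card (ring_center :: 'a::{ring,finite} set) \<ge> 1"
proof -
  have "(0::'a) \<in> ring_center" by (simp add: ring_center_def)
  then show ?thesis by (auto simp: Suc_le_eq card_gt_0_iff)
qed

lemma card_range_commutator_ge_2:
  fixes v :: "'a::{ring,finite}"
  assumes "v \<notin> ring_center"
  shows "card (range (commutator v)) \<ge> 2"
proof -
  obtain x where "commutator v x \<noteq> 0" using assms by (auto simp: ring_center_commutator)
  then have "card {commutator v 0, commutator v x} = 2" by (simp add: commutator_def)
  then show ?thesis by (metis card_mono finite insert_subset empty_subsetI rangeI)
qed

section \<open>Numerical constraints from an end vertex\<close>

lemma end_vertex_nonzero:
  fixes v :: "'a::{ring,finite}"
  assumes "end_vertex Delta_verts (Delta_edges r) v"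
  shows "r \<noteq> 0"
proof
  assume r: "r = 0"
  have v: "v \<notin> ring_center" and deg: "card (neighbours r v) = 1"
    using assms by (auto simp: end_vertex_iff)
  have "neighbours r v = UNIV - centralizer v"
    using centralizer_self[of v]
    by (auto simp: neighbours_def centralizer_def r commutator_center_right)
  then have "CARD('a) = 1 + card (centralizer v)"
    using deg card_Diff_subset[of "centralizer v" UNIV] card_mono[of UNIV "centralizer v"] by simp
  moreover have "CARD('a) \<ge> 2 * card (centralizer v)"
    using card_range_commutator[of v] card_range_commutator_ge_2[OF v] by simp
  moreover have "card (centralizer v) \<ge> 2"
    using two_card_center_le[OF v] card_center_pos[where 'a='a] by simp
  ultimately show False by simp
qed

lemma end_vertex_card:
  fixes v :: "'a::{ring,finite}"
  assumes "end_vertex Delta_verts (Delta_edges r) v" "CARD('a) \<noteq> 8"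
  shows "CARD('a) = 9" "card (ring_center :: 'a set) = 1"
proof -
  have v: "v \<notin> ring_center" and deg: "card (neighbours r v) = 1"
    using assms by (auto simp: end_vertex_iff)
  have r: "r \<noteq> 0" using assms(1) by (rule end_vertex_nonzero)
  define A where "A = {x. commutator v x = r} \<union> {x. commutator v x = - r}"
  define z m k where "z = card (ring_center :: 'a set)" and "m = card (centralizer v)"
    and "k = card (range (commutator v))"
  let ?Z = "ring_center :: 'a set"
  \<comment> \<open>\<open>commutator v\<close> vanishes on the centre and at \<open>v\<close>,
    while its values on \<open>A\<close> are nonzero.\<close>
  have disj: "(?Z \<union> {v}) \<inter> A = {}"
    using r centralizer_self[of v] by (auto simp: A_def commutator_center_right centralizer_def)
  have "neighbours r v = UNIV - (?Z \<union> {v} \<union> A)"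
    by (auto simp: neighbours_def A_def)
  moreover have "card (?Z \<union> {v} \<union> A) = z + 1 + card A"
    using v disj by (subst card_Un_disjoint) (auto simp: z_def)
  ultimately have R: "k * m = z + 2 + card A"
    using deg card_range_commutator[of v] card_Diff_subset[of "?Z \<union> {v} \<union> A" UNIV]
      card_mono[of UNIV "?Z \<union> {v} \<union> A"] by (simp add: k_def m_def)
  have fibre: "card {x. commutator v x = c} \<in> {0, m}" for c
    using card_commutator_fibre[of c v] by (cases "c \<in> range (commutator v)") (auto simp: m_def)
  \<comment> \<open>If \<open>r = - r\<close>, the two fibres coincide and count only once.\<close>
  have "card A = 0 \<or> card A = m \<or> card A = 2 * m"
  proof (cases "r = - r")
    case True
    then show ?thesis using fibre[of r] by (auto simp: A_def)
  next
    case False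
    then have "card A = card {x. commutator v x = r} + card {x. commutator v x = - r}"
      unfolding A_def by (intro card_Un_disjoint) auto
    then show ?thesis using fibre[of r] fibre[of "- r"] by auto
  qed
  then obtain c where "c \<le> 2" and Ac: "card A = c * m"
  proof (elim disjE)
    assume "card A = 0" then show thesis using that[of 0] by simp
  next
    assume "card A = m" then show thesis using that[of 1] by simp
  next
    assume "card A = 2 * m" then show thesis using that[of 2] by simp
  qed
  have km: "k * m = z + 2 + c * m" using R Ac by simp
  have z: "1 \<le> z" "2 * z \<le> m" and k: "2 \<le> k"
    using card_center_pos[where 'a='a] two_card_center_le[OF v] card_range_commutator_ge_2[OF v]
    by (auto simp: z_def m_def k_def)
  \<comment> \<open>\<open>k * m\<close> and \<open>c * m\<close> are multiples of \<open>m\<close>.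
    The resulting bound on \<open>m\<close>, combined with \<open>2 * z \<le> m\<close>, gives
    \<open>z \<le> 2\<close>.\<close>
  have "m dvd z + 2" using km by (metis dvd_add_left_iff dvd_triv_right)
  then have "m \<le> z + 2" by (simp add: dvd_imp_le)
  with z have "z = 1 \<or> z = 2" by linarith
  moreover have "\<not> (2::nat) dvd 3" by simp
  ultimately have zm: "z = 1 \<and> m = 3 \<or> z = 2 \<and> m = 4"
  proof (elim disjE)
    assume "z = 1"
    with z \<open>m \<le> z + 2\<close> have "m = 2 \<or> m = 3" by linarith
    with \<open>m dvd z + 2\<close> \<open>z = 1\<close> show ?thesis by auto
  next
    assume "z = 2"
    with z \<open>m \<le> z + 2\<close> show ?thesis by linarith
  qed
  \<comment> \<open>In both cases \<open>m = z + 2\<close>, so cancelling \<open>m\<close> in the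
    count leaves this.\<close>
  then have kc: "k = c + 1" using km by auto
  with k \<open>c \<le> 2\<close> have "k = 2 \<or> k = 3" by auto
  obtain x where x: "commutator v x \<noteq> 0" using v by (auto simp: ring_center_commutator)
  have "(\<Sum>i<k. commutator v x) = 0" "(\<Sum>i<m. commutator v x) = 0"
    unfolding k_def m_def
    by (rule range_commutator_multiple_eq_0 centralizer_multiple_commutator_eq_0)+
  \<comment> \<open>An element killed by two consecutive numbers is zero. The surviving pairs (3, 3)
    and (2, 4) give orders 9 and 8.\<close>
  then have "\<not> (k = 2 \<and> m = 3)" "\<not> (k = 3 \<and> m = 4)"
    using x by (auto simp: numeral_eq_Suc)
  moreover have "CARD('a) = k * m" using card_range_commutator[of v] by (simp add: k_def m_def)
  ultimately have "CARD('a) = 9 \<and> z = 1" using assms(2) zm \<open>k = 2 \<or> k = 3\<close> by auto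
  then show "CARD('a) = 9" "card (ring_center :: 'a set) = 1" by (auto simp: z_def)
qed

section \<open>Rings of order 9 with trivial centre\<close>

text \<open>The order and the index of the centralizer are at least 2 with product 9, so both are 3,
  and the centralizer consists of the distinct elements 0, \<open>x\<close>,
  \<open>- x\<close>.\<close>

lemma card_9_centralizer:
  fixes x y :: "'a::{ring,finite}"
  assumes "CARD('a) = 9" "card (ring_center :: 'a set) = 1" "x \<noteq> 0"
  shows "x + x + x = 0" and "x * y = y * x \<Longrightarrow> y = 0 \<or> y = x \<or> y = - x"
proof -
  have "(0::'a) \<in> ring_center" by (simp add: ring_center_def)
  with assms(2,3) have x: "x \<notin> ring_center" by (metis card_1_singletonE singletonD)
  define k m where "k = card (range (commutator x))" and "m = card (centralizer x)"
  have km: "k * m = 9" "2 \<le> k" "2 \<le> m"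
    using card_range_commutator[of x] card_range_commutator_ge_2[OF x] two_card_center_le[OF x] assms
    by (auto simp: k_def m_def)
  have "m \<le> 4" using mult_le_mono1[OF \<open>2 \<le> k\<close>, of m] km by simp
  with \<open>2 \<le> m\<close> consider "m = 2" | "m = 3" | "m = 4" by linarith
  then have "m = 3" by cases (use km in presburger)+
  then show three: "x + x + x = 0"
    using centralizer_multiple_eq_0[of x] by (simp add: m_def numeral_eq_Suc add.assoc)
  have "x \<noteq> - x"
  proof
    assume "x = - x"
    then have "x + x = 0" by (simp add: eq_neg_iff_add_eq_0)
    with three assms(3) show False by simp
  qed
  then have "card {0, x, - x} = 3" using assms(3) by auto
  moreover have "{0, x, - x} \<subseteq> centralizer x" by (auto simp: centralizer_def commutator_def)
  ultimately have "centralizer x = {0, x, - x}"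
    using \<open>m = 3\<close> card_subset_eq[of "centralizer x" "{0, x, - x}"] by (simp add: m_def)
  moreover assume "x * y = y * x"
  then have "y \<in> centralizer x" by (simp add: centralizer_def commutator_def)
  ultimately show "y = 0 \<or> y = x \<or> y = - x" by blast
qed

section \<open>Characteristic 3 with every centralizer a line\<close>

context
  assumes three: "\<And>x::'a::ring. x + x + x = 0"
    and line: "\<And>x y::'a. x \<noteq> 0 \<Longrightarrow> x * y = y * x \<Longrightarrow> y = 0 \<or> y = x \<or> y = - x"
begin

lemma square_on_line: "x * x = 0 \<or> x * x = x \<or> x * x = - (x::'a)"
  using line[of x "x * x"] by (cases "x = 0") (auto simp: mult.assoc)

lemma double_eq_minus: "x + x = - (x::'a)"
  using three[of x] by (simp add: eq_neg_iff_add_eq_0)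

lemma neg_eq_self: "- x = (x::'a) \<Longrightarrow> x = 0"
  by (metis three add.left_inverse add_0)

lemma parallelogram: "(x + y) * (x + y) + (x - y) * (x - y) = - (x * x) - (y * (y::'a))"
proof -
  have "(x + y) * (x + y) + (x - y) * (x - y) = (x * x + x * x) + (y * y + y * y)"
    by (simp add: algebra_simps)
  then show ?thesis by (simp add: double_eq_minus)
qed

text \<open>A nonzero common point of the two lines would give 2 y = 0 or 2 x = 0. This is used to
  show that certain squares vanish.\<close>

lemma independent_lines:
  fixes x y :: 'a
  assumes "x * y \<noteq> y * x" "s \<in> {0, x + y, - (x + y)}" "s \<in> {0, x - y, - (x - y)}"
  shows "s = 0"
proof (rule ccontr)
  assume "s \<noteq> 0"
  with assms(2,3) have "x + y = x - y \<or> x + y = y - x"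
    by (metis insertE empty_iff minus_diff_eq minus_minus)
  then have "- y = y \<or> - x = x" by (auto simp: algebra_simps neg_eq_iff_add_eq_0)
  then have "y = 0 \<or> x = 0" using neg_eq_self by metis
  with assms(1) show False by auto
qed

text \<open>Up to sign, \<open>x\<close> and \<open>y\<close> are each square-zero or idempotent.
  The mixed cases are immediate, two square-zero elements are impossible, and for two idempotents
  the difference is square-zero.\<close>

lemma ex_idempotent_square_zero:
  fixes x y :: 'a
  assumes "x * y \<noteq> y * x"
  shows "\<exists>e n::'a. e * e = e \<and> n * n = 0 \<and> e * n \<noteq> n * e"
proof -
  have normalize: "\<exists>x'. (x' = x \<or> x' = - x) \<and> (x' * x' = 0 \<or> x' * x' = x')" for x :: 'a
    using square_on_line[of x] by (metis minus_mult_minus)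
  obtain u v :: 'a where uv: "u = x \<or> u = - x" "v = y \<or> v = - y"
    "u * u = 0 \<or> u * u = u" "v * v = 0 \<or> v * v = v"
    using normalize[of x] normalize[of y] by blast
  have nc: "u * v \<noteq> v * u" using assms uv(1,2) by auto
  note sq = square_on_line[of "u + v"] square_on_line[of "u - v"]
  consider "u * u = 0" "v * v = 0" | "u * u = u" "v * v = 0" | "u * u = 0" "v * v = v"
    | "u * u = u" "v * v = v" using uv(3,4) by blast
  then show ?thesis
  proof cases
    case 1
    \<comment> \<open>The parallelogram identity places this square on the lines of both
      \<open>u + v\<close> and \<open>u - v\<close>, so it is zero and \<open>u\<close>,
      \<open>v\<close> anticommute.\<close>
    have "(u + v) * (u + v) = - ((u - v) * (u - v))"
      using parallelogram[of u v] unfolding 1 eq_neg_iff_add_eq_0 by simp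
    with sq(2) have "(u + v) * (u + v) \<in> {0, u - v, - (u - v)}" by (elim disjE) simp_all
    moreover have "(u + v) * (u + v) \<in> {0, u + v, - (u + v)}" using sq(1) by blast
    ultimately have "(u + v) * (u + v) = 0" by (intro independent_lines[OF nc])
    then have anti: "v * u = - (u * v)"
      using 1 by (simp add: distrib_left distrib_right eq_neg_iff_add_eq_0)
    \<comment> \<open>Now \<open>u v\<close> commutes with both \<open>u\<close> and \<open>v\<close>, hence lies on both lines.\<close>
    have uuv: "u * (u * v) = 0" using 1 by (simp flip: mult.assoc)
    moreover have "(u * v) * u = 0" using uuv by (simp add: mult.assoc anti)
    moreover have uvv: "(u * v) * v = 0" using 1 by (simp add: mult.assoc)
    moreover have "v * (u * v) = 0" using uvv by (simp add: anti flip: mult.assoc)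
    moreover have "u \<noteq> 0" "v \<noteq> 0" using nc by auto
    ultimately have "u * v = 0 \<or> u * v = u \<or> u * v = - u" "u * v = 0 \<or> u * v = v \<or> u * v = - v"
      using line[of u "u * v"] line[of v "u * v"] by simp_all
    moreover have "u \<noteq> v" "u \<noteq> - v" using nc by auto
    ultimately have "u * v = 0" by (metis minus_minus)
    with anti nc show ?thesis by simp
  next
    case 2 then show ?thesis using nc by blast
  next
    case 3 then show ?thesis using nc by metis
  next
    case 4
    define w where "w = u + v"
    have "w * w + (u - v) * (u - v) = - w"
      using parallelogram[of u v] unfolding 4 w_def by simp
    \<comment> \<open>Since \<open>w * w\<close> is on the line of \<open>w\<close>, so is the
      square of \<open>u - v\<close>; it is on the line of \<open>u - v\<close> as well, hence
      zero.\<close>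
    then have "(u - v) * (u - v) = - w - w * w" by (simp add: eq_diff_eq add.commute)
    moreover have "- w - w = w" using double_eq_minus[of "- w"] by simp
    ultimately have "(u - v) * (u - v) \<in> {0, w, - w}"
      using square_on_line[of w] by (elim disjE) simp_all
    moreover have "(u - v) * (u - v) \<in> {0, u - v, - (u - v)}" using sq(2) by blast
    ultimately have "(u - v) * (u - v) = 0"
      unfolding w_def by (intro independent_lines[OF nc])
    moreover have "u * (u - v) \<noteq> (u - v) * u" using nc by (simp add: algebra_simps)
    ultimately show ?thesis using 4 by blast
  qed
qed

lemma idempotent_square_zero_products:
  fixes e n :: 'a
  assumes e: "e * e = e" and n: "n * n = 0" and nc: "e * n \<noteq> n * e"
  shows "e * n = 0 \<and> n * e = n \<or> e * n = n \<and> n * e = 0"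
proof -
  have "n \<noteq> 0" "e \<noteq> 0" using nc by auto
  define t where "t = e * n + n * e"
  have plus: "(e + n) * (e + n) = e + t" and minus: "(e - n) * (e - n) = e - t"
    using e n by (simp_all add: t_def algebra_simps)
  \<comment> \<open>The squares of \<open>e + n\<close> and \<open>e - n\<close> each leave three
    values for \<open>t\<close>, and only \<open>n\<close> is common to both lists.\<close>
  have "t = n"
  proof -
    have "- e - e = e" "e + e = - e"
      using double_eq_minus[of e] double_eq_minus[of "- e"] by simp_all
    have "t = - e \<or> t = n \<or> t = e - n"
      using square_on_line[of "e + n"] unfolding plus
    proof (elim disjE)
      assume "e + t = - (e + n)"
      then have "t = - e - e - n" by (simp add: algebra_simps)
      then show ?thesis using \<open>- e - e = e\<close> by simp
    qed (simp_all add: add_eq_0_iff)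
    moreover have "t = e \<or> t = n \<or> t = - e - n"
      using square_on_line[of "e - n"] unfolding minus
    proof (elim disjE)
      assume "e - t = - (e - n)"
      then have "t = e + e - n" by (simp add: algebra_simps)
      then show ?thesis using \<open>e + e = - e\<close> by simp
    qed simp_all
    moreover have "e - n \<noteq> - e - n" "e \<noteq> - e" using neg_eq_self[of e] \<open>e \<noteq> 0\<close> by auto
    moreover have "e - n \<noteq> e" "- e \<noteq> - e - n" using \<open>n \<noteq> 0\<close> by auto
    ultimately show ?thesis by (elim disjE) simp_all
  qed
  then have sum: "n * e = n - e * n" by (simp add: t_def algebra_simps)
  \<comment> \<open>Both products of \<open>n\<close> with \<open>e * n\<close> vanish, so
    \<open>e * n\<close> is on the line of \<open>n\<close>.\<close>
  have "n * (e * n) = (n - e * n) * n" by (simp add: sum flip: mult.assoc)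
  then have "n * (e * n) = 0" using n by (simp add: left_diff_distrib mult.assoc)
  moreover have "(e * n) * n = 0" using n by (simp add: mult.assoc)
  ultimately have "e * n = 0 \<or> e * n = n \<or> e * n = - n"
    using line[OF \<open>n \<noteq> 0\<close>, of "e * n"] by simp
  \<comment> \<open>Left multiplication by the idempotent \<open>e\<close> cannot have eigenvalue
    -1.\<close>
  moreover have "e * n \<noteq> - n"
  proof
    assume "e * n = - n"
    moreover have "e * (e * n) = e * n" using e by (simp flip: mult.assoc)
    ultimately show False using neg_eq_self[of n] \<open>n \<noteq> 0\<close> by simp
  qed
  ultimately show ?thesis using sum by auto
qed

end

section \<open>Coordinates over the integers modulo 3\<close>

definition act :: "3 \<Rightarrow> 'a::ab_group_add \<Rightarrow> 'a"
  where "act t x = (if t = 0 then 0 else if t = 1 then x else - x)"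

lemma act_simps [simp]: "act 0 x = 0" "act 1 x = x" "act (- 1) x = - x"
  by (simp_all add: act_def)

text \<open>\<open>act\<close> is scalar multiplication with 2 acting as -1, so additivity in the
  scalar rests on \<open>x\<close> being killed by 3.\<close>

lemma act_add:
  assumes "x + x + x = 0"
  shows "act (s + t) x = act s x + act t x"
proof -
  have sums: "1 + 1 = (- 1 :: 3)" "- 1 + - 1 = (1 :: 3)" by simp_all
  have double: "x + x = - x" using assms by (simp add: eq_neg_iff_add_eq_0)
  have "- x + - x = - (x + x)" by simp
  then have "- x + - x = x" unfolding double by simp
  with double show ?thesis
    using three_cases[of s] three_cases[of t]
    by (elim disjE) (simp_all only: sums act_simps add_0_left add_0_right left_minus right_minus)
qed

lemma act_mult: "act (s * t) (x * y) = act s x * act t (y::'a::ring)"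
  using three_cases[of s] three_cases[of t] by auto

lemma card_E_ring: "card (UNIV :: 3 E_ring set) = 9"
proof -
  have "bij (\<lambda>(s::3, t::3). E_elem s t)" by (rule bijI') (auto, metis E_ring.exhaust)
  from bij_betw_same_card[OF this] show ?thesis by simp
qed

lemma card_F_ring: "card (UNIV :: 3 F_ring set) = 9"
proof -
  have "bij (\<lambda>(s::3, t::3). F_elem s t)" by (rule bijI') (auto, metis F_ring.exhaust)
  from bij_betw_same_card[OF this] show ?thesis by simp
qed

text \<open>A nontrivial relation would make \<open>a\<close> or \<open>b\<close> zero, or
  \<open>a\<close> equal to \<open>b\<close> or \<open>- b\<close>, and then they would
  commute.\<close>

lemma act_eq_0_independent:
  fixes a b :: "'a::ring"
  assumes "a * b \<noteq> b * a" "act s a + act t b = 0"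
  shows "s = 0 \<and> t = 0"
  using assms three_cases[of s] three_cases[of t] by (auto simp: add_eq_0_iff)

lemma ring_isomorphism_inv:
  assumes "bij g" "\<And>x y. g (x + y) = g x + g y" "\<And>x y. g (x * y) = g x * g y"
  shows "ring_isomorphism (inv g)"
proof -
  have gi: "g (inv g z) = z" and ig: "inv g (g z') = z'" for z z'
    using assms(1) by (simp_all add: bij_is_surj surj_f_inv_f bij_is_inj)
  have "inv g (z + w) = inv g z + inv g w" "inv g (z * w) = inv g z * inv g w" for z w
    using ig[of "inv g z + inv g w"] ig[of "inv g z * inv g w"] by (simp_all add: gi assms(2,3))
  then show ?thesis using assms(1) by (simp add: ring_isomorphism_def bij_imp_bij_inv)
qed

lemma bij_of_additive_kernel:
  fixes g :: "'b::ab_group_add \<Rightarrow> 'a::{ab_group_add,finite}"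
  assumes "\<And>x y. g (x + y) = g x + g y" "\<And>x. g x = 0 \<Longrightarrow> x = 0" "CARD('b) = CARD('a)"
  shows "bij g"
proof -
  have "inj g"
  proof (rule injI)
    fix x y assume "g x = g y"
    then have "g (x - y) = 0" using assms(1)[of "x - y" y] by simp
    then show "x = y" using assms(2) by fastforce
  qed
  then have "range g = UNIV"
    using assms(3) by (intro card_subset_eq) (auto simp: card_image)
  with \<open>inj g\<close> show ?thesis by (simp add: bij_def)
qed

text \<open>The coordinate map out of E(9) respects products because both sides are bilinear with
  the same relations; independence and equal order make it bijective, and its inverse is the
  isomorphism.\<close>

lemma ring_isomorphism_E_9:
  fixes a b :: "'a::{ring,finite}"
  assumes "CARD('a) = 9" and three: "\<And>x::'a. x + x + x = 0"
    and "a * a = a" "b * b = b" "a * b = a" "b * a = b" "a \<noteq> b"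
  shows "\<exists>f :: 'a \<Rightarrow> 3 E_ring. ring_isomorphism f"
proof -
  define g where "g u = act (E_a u) a + act (E_b u) b" for u
  have add: "g (u + v) = g u + g v" for u v
    by (simp add: g_def plus_E_ring_def act_add[OF three] algebra_simps)
  have "bij g"
  proof (rule bij_of_additive_kernel[OF add])
    fix u assume "g u = 0"
    then show "u = 0" using act_eq_0_independent[of a b] assms
      by (auto simp: g_def zero_E_ring_def E_ring.expand)
  qed (simp add: card_E_ring assms)
  moreover have "g (u * v) = g u * g v" for u v
    by (simp add: g_def times_E_ring_def act_add[OF three] algebra_simps assms flip: act_mult)
  ultimately show ?thesis using ring_isomorphism_inv add by blast
qed

lemma ring_isomorphism_F_9:
  fixes x y :: "'a::{ring,finite}"
  assumes "CARD('a) = 9" and three: "\<And>x::'a. x + x + x = 0"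
    and "x * x = x" "y * y = y" "x * y = y" "y * x = x" "x \<noteq> y"
  shows "\<exists>f :: 'a \<Rightarrow> 3 F_ring. ring_isomorphism f"
proof -
  define g where "g u = act (F_x u) x + act (F_y u) y" for u
  have add: "g (u + v) = g u + g v" for u v
    by (simp add: g_def plus_F_ring_def act_add[OF three] algebra_simps)
  have "bij g"
  proof (rule bij_of_additive_kernel[OF add])
    fix u assume "g u = 0"
    then show "u = 0" using act_eq_0_independent[of x y] assms
      by (auto simp: g_def zero_F_ring_def F_ring.expand)
  qed (simp add: card_F_ring assms)
  moreover have "g (u * v) = g u * g v" for u v
    by (simp add: g_def times_F_ring_def act_add[OF three] algebra_simps assms flip: act_mult)
  ultimately show ?thesis using ring_isomorphism_inv add by blast
qed

lemma card_9_isomorphism: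
  fixes x y :: "'a::{ring,finite}"
  assumes card: "CARD('a) = 9" "card (ring_center :: 'a set) = 1" and "x * y \<noteq> y * x"
  shows "(\<exists>f :: 'a \<Rightarrow> 3 E_ring. ring_isomorphism f) \<or> (\<exists>f :: 'a \<Rightarrow> 3 F_ring. ring_isomorphism f)"
proof -
  have three: "z + z + z = 0" for z :: 'a
    using card_9_centralizer(1)[OF card, of z] by (cases "z = 0") auto
  note line = card_9_centralizer(2)[OF card]
  obtain e n :: 'a where en: "e * e = e" "n * n = 0" "e * n \<noteq> n * e"
    using ex_idempotent_square_zero[OF three line] assms(3) by blast
  then have "e \<noteq> e + n" by auto
  from idempotent_square_zero_products[OF three line en] show ?thesis
  proof
    \<comment> \<open>The generators are \<open>e\<close> and \<open>e + n\<close>: here e (e + n) =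
      e and (e + n) e = e + n.\<close>
    assume "e * n = 0 \<and> n * e = n"
    then have "\<exists>f :: 'a \<Rightarrow> 3 E_ring. ring_isomorphism f"
      using ring_isomorphism_E_9[of e "e + n"] three card en \<open>e \<noteq> e + n\<close> by (simp add: algebra_simps)
    then show ?thesis ..
  next
    \<comment> \<open>With the same generators the two mixed products are interchanged, which gives
      the relations of F(9).\<close>
    assume "e * n = n \<and> n * e = 0"
    then have "\<exists>f :: 'a \<Rightarrow> 3 F_ring. ring_isomorphism f"
      using ring_isomorphism_F_9[of e "e + n"] three card en \<open>e \<noteq> e + n\<close> by (simp add: algebra_simps)
    then show ?thesis ..
  qed
qed

theorem theorem4p6:
  fixes r :: "'a::{ring,finite}"
  assumes noncommutative: "\<exists>x y :: 'a. x * y \<noteq> y * x"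
    and card_ne_8: "CARD('a) \<noteq> 8"
    and r_commutator: "r \<in> commutator_set"
  shows "(\<exists>v. end_vertex Delta_verts (Delta_edges r) v) \<longleftrightarrow>
    r \<noteq> 0 \<and> ((\<exists>f :: 'a \<Rightarrow> 3 E_ring. ring_isomorphism f) \<or> (\<exists>f :: 'a \<Rightarrow> 3 F_ring. ring_isomorphism f))"
proof
  assume "\<exists>v. end_vertex Delta_verts (Delta_edges r) v"
  then obtain v where v: "end_vertex Delta_verts (Delta_edges r) v" ..
  obtain x y :: 'a where "x * y \<noteq> y * x" using noncommutative by blast
  with card_9_isomorphism[OF end_vertex_card[OF v card_ne_8]] end_vertex_nonzero[OF v]
  show "r \<noteq> 0 \<and> ((\<exists>f :: 'a \<Rightarrow> 3 E_ring. ring_isomorphism f) \<or> (\<exists>f :: 'a \<Rightarrow> 3 F_ring. ring_isomorphism f))"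
    by simp
next
  assume "r \<noteq> 0 \<and> ((\<exists>f :: 'a \<Rightarrow> 3 E_ring. ring_isomorphism f) \<or> (\<exists>f :: 'a \<Rightarrow> 3 F_ring. ring_isomorphism f))"
  then have "r \<noteq> 0" and "(\<exists>f :: 'a \<Rightarrow> 3 E_ring. ring_isomorphism f) \<or> (\<exists>f :: 'a \<Rightarrow> 3 F_ring. ring_isomorphism f)"
    by simp_all
  then show "\<exists>v. end_vertex Delta_verts (Delta_edges r) v"
  proof (elim disjE exE)
    fix f :: "'a \<Rightarrow> 3 E_ring" assume "ring_isomorphism f"
    then show ?thesis using r_commutator \<open>r \<noteq> 0\<close> E_end_vertex by (rule iso_ex_end_vertex)
  next
    fix f :: "'a \<Rightarrow> 3 F_ring" assume "ring_isomorphism f"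
    then show ?thesis using r_commutator \<open>r \<noteq> 0\<close> F_end_vertex by (rule iso_ex_end_vertex)
  qed
qed

end
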